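(* Let $n\geqslant 1$ and $\beta\geqslant 1$ be integers and let $x_1,\dots,x_n$ be indeterminates. Then, as an identity of rational functions in $x_1,\dots,x_n$ over $\mathbb{Q}$, \[ \det_{1\leqslant i,j\leqslant n} \left( \frac{(\beta-1)!}{(x_i+j+1)_\beta} \right) = \frac{(\beta-1)!\,\beta!\cdots (\beta+n-2)!}{(x_1+2)_{\beta+n-1}\cdots (x_n+2)_{\beta+n-1}} \prod_{1\leqslant i<j\leqslant n} (x_j-x_i). \]
   Context: For an integer $m\geqslant 0$, $(x)_m = x(x+1)\cdots(x+m-1)$ denotes the Pochhammer symbol (shifted factorial), with $(x)_0=1$. The product $(\beta-1)!\,\beta!\cdots(\beta+n-2)!$ is $\prod_{k=0}^{n-1}(\beta-1+k)!$, and an empty product equals $1$. *)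

theory Defs
  imports
    "HOL-Library.Poly_Mapping"
    "HOL-Computational_Algebra.Fraction_Field"
    "HOL-Computational_Algebra.Polynomial_Factorial"
    "Jordan_Normal_Form.Determinant"
begin

text \<open>
  A monomial is a finitely supported exponent function on the variable indices, and a
  polynomial is a finitely supported map from monomials to coefficients. There is one
  variable for every natural number, so that a single type serves all numbers of variables;
  the field of rational functions in the first few variables is a subfield of
  \<open>rat_fun\<close>.
\<close>

type_synonym rat_mpoly = "(nat \<Rightarrow>\<^sub>0 nat) \<Rightarrow>\<^sub>0 rat"

type_synonym rat_fun = "rat_mpoly fract"

definition indet_poly :: "nat \<Rightarrow> rat_mpoly" where
  "indet_poly i = Poly_Mapping.single (Poly_Mapping.single i 1) 1"

definition indet :: "nat \<Rightarrow> rat_fun" where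
  "indet i = to_fract (indet_poly i)"

end

theory Submission
  imports Defs
begin

text \<open>
  Put f b x = b! / (x)_(b+1). Then f (b+1) x = f b x - f b (x+1), so repeated column differences,
  which do not change the determinant, turn the entry f b (y i + j) into
  f (b+n-1-j) (y i + j) = (b+n-1-j)! (y i)_j / (y i)_(b+n). Rows and columns now factor out,
  leaving the matrix of the (y i)_j. Expanding (x)_j, monic of degree j, in the Newton basis
  of the nodes y 0, y 1, \<dots> writes this matrix as a lower triangular one times a unitriangular one,
  so that its determinant is the Vandermonde product.
\<close>

text \<open>The coefficients are chosen before \<open>x\<close>, so one column of them serves all
  rows of a matrix.\<close>

lemma pochhammer_newton_expansion:
  fixes y :: "nat \<Rightarrow> 'a::comm_ring_1"
  shows "\<exists>c. c j = 1 \<and> (\<forall>k>j. c k = 0) \<and>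
    (\<forall>x. pochhammer x j = (\<Sum>k\<le>j. (\<Prod>l<k. x - y l) * c k))"
proof (induction j)
  case 0
  show ?case
    by (rule exI[of _ "\<lambda>k. if k = 0 then 1 else 0"]) auto
next
  case (Suc j)
  then obtain c where c: "c j = 1" "\<And>k. k > j \<Longrightarrow> c k = 0"
    and exp: "\<And>x. pochhammer x j = (\<Sum>k\<le>j. (\<Prod>l<k. x - y l) * c k)"
    by auto
  \<comment> \<open>Multiplying by x + j = (x - y k) + (y k + j) sends the k-th Newton product to
    the next one plus (y k + j) times itself. Hence a shifted copy of \<open>c\<close> plus a
    rescaled one.\<close>
  define d where "d = (\<lambda>k. (case k of 0 \<Rightarrow> 0 | Suc k' \<Rightarrow> c k') + (y k + of_nat j) * c k)"
  have "pochhammer x (Suc j) = (\<Sum>k\<le>Suc j. (\<Prod>l<k. x - y l) * d k)" for x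
  proof -
    let ?N = "\<lambda>k. \<Prod>l<k. x - y l"
    have "pochhammer x (Suc j) = (\<Sum>k\<le>j. ?N k * c k) * (x + of_nat j)"
      by (simp add: pochhammer_Suc exp)
    also have "\<dots> = (\<Sum>k\<le>j. ?N (Suc k) * c k + ?N k * ((y k + of_nat j) * c k))"
      unfolding sum_distrib_right by (intro sum.cong refl) (simp add: algebra_simps)
    also have "\<dots> = (\<Sum>k\<le>j. ?N (Suc k) * c k) + (\<Sum>k\<le>j. ?N k * ((y k + of_nat j) * c k))"
      by (rule sum.distrib)
    also have "(\<Sum>k\<le>j. ?N (Suc k) * c k)
        = (\<Sum>k\<le>Suc j. ?N k * (case k of 0 \<Rightarrow> 0 | Suc k' \<Rightarrow> c k'))"
      by (subst sum.atMost_Suc_shift) simp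
    also have "(\<Sum>k\<le>j. ?N k * ((y k + of_nat j) * c k))
        = (\<Sum>k\<le>Suc j. ?N k * ((y k + of_nat j) * c k))"
      by (simp add: c)
    finally show ?thesis
      by (simp only: d_def distrib_left sum.distrib)
  qed
  moreover have "d (Suc j) = 1" "\<forall>k>Suc j. d k = 0"
    by (auto simp: d_def c split: nat.split)
  ultimately show ?case
    by blast
qed

lemma det_pochhammer:
  fixes y :: "nat \<Rightarrow> 'a::idom"
  shows "det (mat n n (\<lambda>(i, j). pochhammer (y i) j)) = (\<Prod>i<n. \<Prod>k<i. y i - y k)"
proof -
  obtain c where c: "\<And>j. c j j = 1" "\<And>j k. k > j \<Longrightarrow> c j k = 0"
    and exp: "\<And>j x. pochhammer x j = (\<Sum>k\<le>j. (\<Prod>l<k. x - y l) * c j k)"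
    using pochhammer_newton_expansion[of _ y] by metis
  let ?N = "mat n n (\<lambda>(i, k). \<Prod>l<k. y i - y l)" and ?C = "mat n n (\<lambda>(k, j). c j k)"
  have "mat n n (\<lambda>(i, j). pochhammer (y i) j) = ?N * ?C"
  proof (rule eq_matI; clarsimp simp: scalar_prod_def exp)
    fix i j assume "j < n"
    then show "(\<Sum>k\<le>j. (\<Prod>l<k. y i - y l) * c j k)
        = (\<Sum>k = 0..<n. (\<Prod>l<k. y i - y l) * c j k)"
      by (intro sum.mono_neutral_left) (auto simp: c)
  qed
  \<comment> \<open>For k > i the product contains the factor y i - y i = 0.\<close>
  moreover have "det ?N = (\<Prod>i<n. \<Prod>k<i. y i - y k)"
    by (subst det_lower_triangular[of n]) (auto simp: prod_list_diag_prod lessThan_atLeast0)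
  moreover have "det ?C = 1"
    by (subst det_upper_triangular[of _ n]) (auto simp: prod_list_diag_prod c)
  ultimately show ?thesis
    by (simp add: det_mult[of _ n])
qed

text \<open>Induction on \<open>m\<close> by Pascal's rule. The recurrence is only required on the
  triangle m + j < N: reaching \<open>f m j\<close> uses no index j + k beyond
  \<open>N\<close>.\<close>

lemma iterated_difference:
  fixes f :: "nat \<Rightarrow> nat \<Rightarrow> 'a::comm_ring_1"
  assumes "\<And>m j. m + j < N \<Longrightarrow> f (Suc m) j = f m j - f m (Suc j)" "m + j \<le> N"
  shows "f m j = (\<Sum>k\<le>m. f 0 (j + k) * ((- 1) ^ k * of_nat (m choose k)))"
  using assms(2)
proof (induction m arbitrary: j)
  case 0
  then show ?case by simp
next
  case (Suc m)
  let ?g = "\<lambda>k. f 0 (j + k) * (- 1) ^ k"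
  have "f (Suc m) j = f m j - f m (Suc j)"
    using assms(1) Suc.prems by simp
  \<comment> \<open>The extra term vanishes since \<open>m choose Suc m\<close> is 0; it aligns the
    range with that of the shifted sum.\<close>
  also have "f m j = (\<Sum>k\<le>Suc m. ?g k * of_nat (m choose k))"
    using Suc.IH[of j] Suc.prems by (simp add: mult.assoc binomial_eq_0)
  also have "f m (Suc j) = - (\<Sum>k\<le>m. ?g (Suc k) * of_nat (m choose k))"
    using Suc.IH[of "Suc j"] Suc.prems by (simp add: mult.assoc sum_negf)
  also have "(\<Sum>k\<le>Suc m. ?g k * of_nat (m choose k)) - - (\<Sum>k\<le>m. ?g (Suc k) * of_nat (m choose k))
      = (\<Sum>k\<le>Suc m. ?g k * of_nat (Suc m choose k))"
    unfolding sum.atMost_Suc_shift by (simp add: sum.distrib[symmetric] algebra_simps)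
  finally show ?case
    by (simp only: mult.assoc)
qed

text \<open>Column j is differenced n - 1 - j times, the most that the columns to its right allow.
  All these column operations together are right multiplication by the unitriangular matrix
  \<open>?L\<close>.\<close>

lemma det_iterated_difference:
  fixes f :: "'a::idom \<Rightarrow> nat \<Rightarrow> nat \<Rightarrow> 'a"
  assumes "\<And>i m j. i < n \<Longrightarrow> m + j < n - 1 \<Longrightarrow> f (y i) (Suc m) j = f (y i) m j - f (y i) m (Suc j)"
  shows "det (mat n n (\<lambda>(i, j). f (y i) 0 j)) = det (mat n n (\<lambda>(i, j). f (y i) (n - 1 - j) j))"
proof -
  let ?F = "mat n n (\<lambda>(i, j). f (y i) 0 j)"
  let ?L = "mat n n (\<lambda>(l, j).
      if j \<le> l then (- 1) ^ (l - j) * of_nat ((n - 1 - j) choose (l - j)) else (0 :: 'a))"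
  have "mat n n (\<lambda>(i, j). f (y i) (n - 1 - j) j) = ?F * ?L"
  proof (rule eq_matI)
    fix i j assume "i < dim_row (?F * ?L)" "j < dim_col (?F * ?L)"
    then have i: "i < n" and j: "j < n"
      by simp_all
    have "f (y i) (n - 1 - j) j
        = (\<Sum>k\<le>n - 1 - j. f (y i) 0 (j + k) * ((- 1) ^ k * of_nat ((n - 1 - j) choose k)))"
      by (rule iterated_difference[of "n - 1"]) (use assms i j in auto)
    also have "\<dots> = (\<Sum>l\<in>{j..<n}. f (y i) 0 l * ((- 1) ^ (l - j) * of_nat ((n - 1 - j) choose (l - j))))"
      by (rule sum.reindex_bij_witness[of _ "\<lambda>l. l - j" "\<lambda>k. j + k"]) (use j in auto)
    also have "\<dots> = (\<Sum>l = 0..<n. f (y i) 0 l *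
          (if j \<le> l then (- 1) ^ (l - j) * of_nat ((n - 1 - j) choose (l - j)) else 0))"
      by (intro sum.mono_neutral_cong_left) auto
    finally show "mat n n (\<lambda>(i, j). f (y i) (n - 1 - j) j) $$ (i, j) = (?F * ?L) $$ (i, j)"
      using i j by (simp add: scalar_prod_def cong: if_cong)
  qed simp_all
  moreover have "det ?L = 1"
    by (subst det_lower_triangular[of n]) (auto simp: prod_list_diag_prod)
  ultimately show ?thesis
    by (simp add: det_mult[of _ n] cong: if_cong)
qed

lemma det_scale_rows_cols:
  fixes a b :: "nat \<Rightarrow> 'a::idom"
  shows "det (mat n n (\<lambda>(i, j). a i * g i j * b j))
    = prod a {0..<n} * det (mat n n (\<lambda>(i, j). g i j)) * prod b {0..<n}"
proof -
  have d: "det (mat_diag n h) = prod h {0..<n}" for h :: "nat \<Rightarrow> 'a"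
    by (subst det_upper_triangular[of _ n]) (auto simp: mat_diag_def prod_list_diag_prod)
  have "mat n n (\<lambda>(i, j). a i * g i j * b j) = mat_diag n a * mat n n (\<lambda>(i, j). g i j) * mat_diag n b"
    by (subst mat_diag_mult_left[of _ n n], simp, subst mat_diag_mult_right[of _ n n]) auto
  then show ?thesis
    by (simp add: det_mult[of _ n] mult_carrier_mat[of _ n n _ n] d)
qed

text \<open>Over the common denominator x (x+1)_b (x+1+b) the numerator is b! ((x+1+b) - x) =
  (b+1)!.\<close>

lemma fact_div_pochhammer_difference:
  fixes x :: "'a::field"
  assumes "pochhammer x (b + 2) \<noteq> 0"
  shows "of_nat (fact (Suc b)) / pochhammer x (Suc (Suc b))
    = of_nat (fact b) / pochhammer x (Suc b) - of_nat (fact b) / pochhammer (x + 1) (Suc b)"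
proof -
  define q where "q = pochhammer (x + 1) b"
  have eqs: "pochhammer x (Suc b) = x * q" "pochhammer (x + 1) (Suc b) = q * (x + 1 + of_nat b)"
    "pochhammer x (Suc (Suc b)) = x * (q * (x + 1 + of_nat b))"
    by (simp_all only: q_def pochhammer_rec[of x] pochhammer_Suc[of "x + 1"])
  have nz: "x \<noteq> 0" "q \<noteq> 0" "x + 1 + of_nat b \<noteq> 0"
    using assms eqs by auto
  show ?thesis
    unfolding eqs using nz by (simp add: divide_simps) (simp add: algebra_simps)
qed

lemma det_fact_div_pochhammer:
  fixes y :: "nat \<Rightarrow> 'a::field"
  assumes nz: "\<And>i. i < n \<Longrightarrow> pochhammer (y i) (b + n) \<noteq> 0"
  shows "det (mat n n (\<lambda>(i, j). of_nat (fact b) / pochhammer (y i + of_nat j) (Suc b)))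
    = of_nat (\<Prod>k = 0..<n. fact (b + k)) / (\<Prod>i = 0..<n. pochhammer (y i) (b + n))
        * (\<Prod>i<n. \<Prod>k<i. y i - y k)"
proof -
  \<comment> \<open>Here \<open>m\<close> counts the differences already taken, so m = 0 gives the
    original entries.\<close>
  define f where
    "f = (\<lambda>(x::'a) m j. of_nat (fact (b + m)) / pochhammer (x + of_nat j) (Suc (b + m)) :: 'a)"
  have "f (y i) (Suc m) j = f (y i) m j - f (y i) m (Suc j)" if "i < n" "m + j < n - 1" for i m j
  proof -
    \<comment> \<open>The Pochhammer symbol below is the middle block of (y i)_(b+n) in this
      splitting, so it inherits being nonzero.\<close>
    have "b + n = j + (b + m + 2) + (n - (j + m + 2))"
      using that by simp
    then have "pochhammer (y i + of_nat j) (b + m + 2) \<noteq> 0"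
      using nz[OF that(1)] by (metis pochhammer_product' mult_eq_0_iff)
    then show ?thesis
      using fact_div_pochhammer_difference[of "y i + of_nat j" "b + m"]
      by (simp add: f_def algebra_simps)
  qed
  then have "det (mat n n (\<lambda>(i, j). f (y i) 0 j)) = det (mat n n (\<lambda>(i, j). f (y i) (n - 1 - j) j))"
    by (rule det_iterated_difference)
  also have "mat n n (\<lambda>(i, j). f (y i) (n - 1 - j) j)
      = mat n n (\<lambda>(i, j). inverse (pochhammer (y i) (b + n)) * pochhammer (y i) j *
          of_nat (fact (b + (n - 1 - j))))"
    (is "?A = ?B")
  proof (rule eq_matI)
    fix i j assume "i < dim_row ?B" "j < dim_col ?B"
    then have ij: "i < n" "j < n"
      by simp_all
    \<comment> \<open>After n - 1 - j differences the denominator ends at the factor y i + b + n - 1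
      whatever j is. Completing it by (y i)_j makes it depend on the row only.\<close>
    then have "pochhammer (y i) (b + n)
        = pochhammer (y i) j * pochhammer (y i + of_nat j) (Suc (b + (n - 1 - j)))"
      by (simp add: pochhammer_product' [symmetric])
    then show "?A $$ (i, j) = ?B $$ (i, j)"
      using nz[OF ij(1)] ij by (simp add: f_def field_simps)
  qed simp_all
  also have "det \<dots> = (\<Prod>i = 0..<n. inverse (pochhammer (y i) (b + n)))
      * (\<Prod>i<n. \<Prod>k<i. y i - y k) * (\<Prod>j = 0..<n. of_nat (fact (b + (n - 1 - j))))"
    by (simp only: det_scale_rows_cols det_pochhammer)
  also have "(\<Prod>j = 0..<n. of_nat (fact (b + (n - 1 - j))) :: 'a) = (\<Prod>k = 0..<n. of_nat (fact (b + k)))"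
    by (rule prod.reindex_bij_witness[of _ "\<lambda>j. n - 1 - j" "\<lambda>j. n - 1 - j"]) auto
  finally show ?thesis
    by (simp add: f_def prod_inversef[symmetric] divide_inverse mult_ac)
qed

text \<open>The monomial of the variable has coefficient 1 in the polynomial, as the constant only
  touches the monomial 0; \<open>to_fract\<close> is injective.\<close>

lemma indet_add_of_nat_neq_0: "indet i + of_nat k \<noteq> 0"
proof -
  have "Poly_Mapping.single i (1::nat) \<noteq> 0"
    by (metis lookup_single_eq lookup_zero one_neq_zero)
  then have "Poly_Mapping.lookup (indet_poly i + of_nat k) (Poly_Mapping.single i (1::nat)) \<noteq> 0"
    by (simp add: indet_poly_def Poly_Mapping.lookup_add Poly_Mapping.lookup_of_nat)
  then have "indet_poly i + of_nat k \<noteq> 0"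
    by auto
  moreover have "indet i + of_nat k = to_fract (indet_poly i + of_nat k)"
    by (simp add: indet_def to_fract_def of_nat_fract)
  ultimately show ?thesis
    by (simp del: to_fract_add)
qed

lemma pochhammer_indet_neq_0: "pochhammer (indet i + of_nat k) m \<noteq> 0"
  using indet_add_of_nat_neq_0[of i]
  by (auto simp: pochhammer_prod add.assoc simp flip: of_nat_add)

theorem mainTheorem1:
  fixes n \<beta> :: nat
  assumes "n \<ge> 1" and "\<beta> \<ge> 1"
  shows "det (mat n n (\<lambda>(i, j).
             of_nat (fact (\<beta> - 1)) / pochhammer (indet (i + 1) + of_nat (j + 1) + 1) \<beta>))
       = of_nat (\<Prod>k = 0..<n. fact (\<beta> - 1 + k))
           / (\<Prod>i = 1..n. pochhammer (indet i + 2) (\<beta> + n - 1))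
         * (\<Prod>(i, j) \<in> {(i, j). 1 \<le> i \<and> i < j \<and> j \<le> n}. indet j - indet i)"
proof -
  obtain b where b: "\<beta> = Suc b"
    using assms(2) by (cases \<beta>) auto
  \<comment> \<open>Matrix indices start at 0: the entry's x_(i+1) + (j+1) + 1 becomes y i + j, and
    the shift by 2 cancels in the differences.\<close>
  define y where "y = (\<lambda>i. indet (i + 1) + 2)"
  have "(\<Prod>i = 0..<n. pochhammer (y i) (b + n)) = (\<Prod>i = 1..n. pochhammer (indet i + 2) (b + n))"
    by (rule prod.reindex_bij_witness[of _ "\<lambda>i. i - 1" Suc]) (auto simp: y_def)
  moreover have "(\<Prod>i<n. \<Prod>k<i. y i - y k)
      = (\<Prod>(i, j) \<in> {(i, j). 1 \<le> i \<and> i < j \<and> j \<le> n}. indet j - indet i)"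
    \<comment> \<open>The pair (i, k) with k < i corresponds to (k + 1, i + 1), smaller index
      first.\<close>
    by (subst prod.Sigma, simp, simp,
        rule prod.reindex_bij_witness[of _ "\<lambda>(i, j). (j - 1, i - 1)" "\<lambda>(i, k). (k + 1, i + 1)"])
       (auto simp: y_def)
  moreover have "pochhammer (y i) (b + n) \<noteq> 0" for i
    using pochhammer_indet_neq_0[of "i + 1" 2] by (simp add: y_def)
  then have "det (mat n n (\<lambda>(i, j). of_nat (fact b) / pochhammer (y i + of_nat j) (Suc b)))
    = of_nat (\<Prod>k = 0..<n. fact (b + k)) / (\<Prod>i = 0..<n. pochhammer (y i) (b + n))
        * (\<Prod>i<n. \<Prod>k<i. y i - y k)"
    by (rule det_fact_div_pochhammer)
  moreover have "y i + of_nat j = indet (i + 1) + of_nat (j + 1) + 1" for i j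
    by (simp add: y_def)
  ultimately show ?thesis
    by (simp only: b diff_Suc_1 add_Suc)
qed

end
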